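(* Let $\varphi\in L_1(\mathbb{R}^d)\cap L_2(\mathbb{R}^d)$ satisfy the refinement equation $\hat\varphi(2u)=H(z)\hat\varphi(u)$, $z=e^{-iu}$, $u\in\mathbb{R}^d$, with a Laurent polynomial $H\in\mathcal{L}$, let $\Phi(z)=\sum_{k\in\mathbb{Z}^d}\tilde\varphi(k)z^k\in\mathcal{L}$ be a Laurent polynomial, and assume there are constants $A,B>0$ with $A\le\Phi(z)\le B$ for all $z\in\mathbb{T}^d$. Let $c\in\mathbb{C}$, $c\ne0$, and let $U(z)=cH(z)\Phi(z)=\sum_{j\in E}u_jz^j$ with $u_j\in\mathcal{L}_\downarrow(\ell_1)$. Suppose that $u_i$ is invertible in $\mathcal{L}_\downarrow(\ell_1)$ for some $i\in E$. Put $H_{|j-i|}=\overline{u_j}\,z^i-\overline{u_i}\,z^j$ for all $j\in E\setminus\{i\}$. Then: (i) $\langle H,H_j\rangle_\Phi=0$ for all $j\in E\setminus\{0\}$; (ii) the polynomials $\{H_j:j\in E\setminus\{0\}\}$ together with $H$ form a basis of $\mathcal{L}(\ell_1)$ over $\mathcal{L}_\downarrow(\ell_1)$.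
   Context: $E=\{0,1\}^d$; $\mathbb{T}^d=\{z\in\mathbb{C}^d:|z_j|=1\}$; $z^k=z_1^{k_1}\cdots z_d^{k_d}$; $e^{-iu}=(e^{-iu_1},\dots,e^{-iu_d})$. $\hat f(u)=\int_{\mathbb{R}^d}f(x)e^{-iu^Tx}dx$; $\tilde\varphi(u)=\int_{\mathbb{R}^d}\varphi(t)\overline{\varphi(t-u)}\,dt$ is the autocorrelation function, and $\Phi(e^{-iu})=\sum_{k\in\mathbb{Z}^d}|\hat\varphi(u+2\pi k)|^2$. $\mathcal{L}$ is the ring of Laurent polynomials in $z_1,\dots,z_d$ over $\mathbb{C}$; $\mathcal{L}(\ell_1)$ is the ring of Laurent series $\sum_{k\in\mathbb{Z}^d}a_kz^k$ with $a\in\ell_1(\mathbb{Z}^d)$, considered as functions on $\mathbb{T}^d$; $\mathcal{L}_\downarrow=\{P(z^2):P\in\mathcal{L}\}$, $\mathcal{L}_\downarrow(\ell_1)=\{F(z^2):F\in\mathcal{L}(\ell_1)\}$ with $z^2=(z_1^2,\dots,z_d^2)$. Conjugation: $\overline{\sum a_kz^k}=\sum\overline{a_k}z^{-k}$. For $F,G\in\mathcal{L}(\ell_1)$, $\langle F,G\rangle_\Phi(z)=\sum_{s\in E}\Phi((-1)^sz)F((-1)^sz)\overline{G((-1)^sz)}\in\mathcal{L}_\downarrow(\ell_1)$, where $(-1)^sz=((-1)^{s_1}z_1,\dots,(-1)^{s_d}z_d)$. For $k\in\mathbb{Z}^d$, $|k|=(|k_1|,\dots,|k_d|)$; for fixed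 $i\in E$, $j\mapsto|j-i|$ is a bijection of $E\setminus\{i\}$ onto $E\setminus\{0\}$, so $H_s$ is defined for all $s\in E\setminus\{0\}$. *)

theory Defs
  imports "HOL-Analysis.Analysis"
begin

section \<open>Fourier transform and autocorrelation\<close>

definition fourier_transform :: "(real^'d::finite \<Rightarrow> complex) \<Rightarrow> real^'d \<Rightarrow> complex" where
  "fourier_transform f u =
     integral\<^sup>L lebesgue (\<lambda>x. f x * exp (- (\<i> * complex_of_real (u \<bullet> x))))"

definition autocorrelation :: "(real^'d::finite \<Rightarrow> complex) \<Rightarrow> real^'d \<Rightarrow> complex" where
  "autocorrelation \<phi> u = integral\<^sup>L lebesgue (\<lambda>t. \<phi> t * cnj (\<phi> (t - u)))"

section \<open>Torus, monomials and cosets\<close>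

definition torus :: "(complex^'d::finite) set" where
  "torus = {z. \<forall>l. cmod (z $ l) = 1}"

definition torus_point :: "real^'d::finite \<Rightarrow> complex^'d" where
  "torus_point u = (\<chi> l. exp (- (\<i> * complex_of_real (u $ l))))"

definition monomial :: "complex^'d::finite \<Rightarrow> int^'d \<Rightarrow> complex" where
  "monomial z k = (\<Prod>l\<in>UNIV. z $ l powi k $ l)"

definition square_point :: "complex^'d::finite \<Rightarrow> complex^'d" where
  "square_point z = (\<chi> l. (z $ l)\<^sup>2)"

definition sign_twist :: "int^'d::finite \<Rightarrow> complex^'d \<Rightarrow> complex^'d" where
  "sign_twist s z = (\<chi> l. (- 1) powi (s $ l) * z $ l)"

definition cube :: "(int^'d::finite) set" where
  "cube = {k. \<forall>l. k $ l \<in> {0, 1}}"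

definition vec_abs :: "int^'d::finite \<Rightarrow> int^'d" where
  "vec_abs k = (\<chi> l. \<bar>k $ l\<bar>)"

definition int_to_real_vec :: "int^'d::finite \<Rightarrow> real^'d" where
  "int_to_real_vec k = (\<chi> l. real_of_int (k $ l))"

section \<open>Rings of Laurent polynomials and series\<close>

text \<open>
  Elements of these rings are functions on the torus. They are represented by total functions
  of which only the values on \<^const>\<open>torus\<close> matter; equality of two elements is always stated
  as equality at all points of \<^const>\<open>torus\<close>.
\<close>

definition laurent_polys :: "(complex^'d::finite \<Rightarrow> complex) set" where
  "laurent_polys = {F. \<exists>a. finite {k. a k \<noteq> 0} \<and>
     (\<forall>z\<in>torus. F z = (\<Sum>k | a k \<noteq> 0. a k * monomial z k))}"

definition laurent_l1 :: "(complex^'d::finite \<Rightarrow> complex) set" where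
  "laurent_l1 = {F. \<exists>a. (\<lambda>k. cmod (a k)) summable_on UNIV \<and>
     (\<forall>z\<in>torus. F z = (\<Sum>\<^sub>\<infinity>k. a k * monomial z k))}"

definition laurent_l1_down :: "(complex^'d::finite \<Rightarrow> complex) set" where
  "laurent_l1_down = {F. \<exists>P\<in>laurent_l1. \<forall>z\<in>torus. F z = P (square_point z)}"

definition invertible_l1_down :: "(complex^'d::finite \<Rightarrow> complex) \<Rightarrow> bool" where
  "invertible_l1_down F \<longleftrightarrow>
     F \<in> laurent_l1_down \<and> (\<exists>G\<in>laurent_l1_down. \<forall>z\<in>torus. F z * G z = 1)"

text \<open>The finite family \<open>b\<close>, indexed by \<open>I\<close>, is a basis of the module \<^const>\<open>laurent_l1\<close>
  over the ring \<^const>\<open>laurent_l1_down\<close>.\<close>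

definition l1_basis :: "'i set \<Rightarrow> ('i \<Rightarrow> complex^'d::finite \<Rightarrow> complex) \<Rightarrow> bool" where
  "l1_basis I b \<longleftrightarrow> finite I \<and> (\<forall>j\<in>I. b j \<in> laurent_l1) \<and>
     (\<forall>F\<in>laurent_l1. \<exists>g. (\<forall>j\<in>I. g j \<in> laurent_l1_down) \<and>
        (\<forall>z\<in>torus. F z = (\<Sum>j\<in>I. g j z * b j z))) \<and>
     (\<forall>g. (\<forall>j\<in>I. g j \<in> laurent_l1_down) \<and> (\<forall>z\<in>torus. (\<Sum>j\<in>I. g j z * b j z) = 0) \<longrightarrow>
        (\<forall>j\<in>I. \<forall>z\<in>torus. g j z = 0))"

text \<open>The conjugation \<open>\<Sum> a\<^sub>k z\<^sup>k \<mapsto> \<Sum> cnj a\<^sub>k z\<^sup>-\<^sup>k\<close> is pointwise complex conjugation on the torus.\<close>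

lemma cnj_monomial:
  assumes "z \<in> torus"
  shows "cnj (monomial z k) = monomial z (- k)"
proof -
  have "cnj (z $ l powi m) = z $ l powi (- m)" for l m
  proof -
    have 1: "cmod (z $ l) = 1" using assms by (simp add: torus_def)
    have "z $ l * cnj (z $ l) = 1"
      by (simp add: complex_mult_cnj cmod_power2 [symmetric] 1)
    then have "cnj (z $ l) = inverse (z $ l)"
      by (metis inverse_unique)
    then show ?thesis
      by (simp add: power_int_minus power_int_inverse)
  qed
  then show ?thesis by (simp add: monomial_def)
qed

lemma cnj_laurent_series:
  assumes "z \<in> torus"
  shows "cnj (\<Sum>\<^sub>\<infinity>k. a k * monomial z k) = (\<Sum>\<^sub>\<infinity>k. cnj (a k) * monomial z (- k))"
  by (simp add: cnj_monomial [OF assms] flip: infsum_cnj)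

section \<open>The symbol of the autocorrelation and the bracket product\<close>

definition autocorr_symbol :: "(real^'d::finite \<Rightarrow> complex) \<Rightarrow> complex^'d \<Rightarrow> complex" where
  "autocorr_symbol \<phi> z = (\<Sum>\<^sub>\<infinity>k. autocorrelation \<phi> (int_to_real_vec k) * monomial z k)"

definition bracket ::
  "(complex^'d::finite \<Rightarrow> complex) \<Rightarrow> (complex^'d \<Rightarrow> complex) \<Rightarrow> (complex^'d \<Rightarrow> complex)
    \<Rightarrow> complex^'d \<Rightarrow> complex" where
  "bracket \<Phi> F G z =
     (\<Sum>s\<in>cube. \<Phi> (sign_twist s z) * F (sign_twist s z) * cnj (G (sign_twist s z)))"

lemma bij_betw_vec_abs_diff:
  fixes i :: "int^'d::finite"
  assumes "i \<in> cube"
  shows "bij_betw (\<lambda>j. vec_abs (j - i)) (cube - {i}) (cube - {0})"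
proof -
  have a: "\<bar>\<bar>x - y\<bar> - y\<bar> = x" "\<bar>x - y\<bar> \<in> {0, 1}" if "x \<in> {0, 1}" "y \<in> {0, 1}" for x y :: int
    using that by auto
  have inv: "vec_abs (vec_abs (j - i) - i) = j" if "j \<in> cube" for j
    using a(1) assms that by (simp add: vec_abs_def cube_def vec_eq_iff)
  have cl: "vec_abs (j - i) \<in> cube" if "j \<in> cube" for j
    using a(2) assms that by (simp add: vec_abs_def cube_def)
  have z: "vec_abs (j - i) = 0 \<longleftrightarrow> j = i" for j
    by (simp add: vec_abs_def vec_eq_iff)
  have z': "vec_abs (0 - i) = i"
    using assms by (force simp: vec_abs_def cube_def vec_eq_iff abs_if)
  have w: "j = 0" if "j \<in> cube" "vec_abs (j - i) = i" for j
    using inv [OF that(1)] that(2) z [of i] by simp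
  show ?thesis
    by (rule bij_betw_byWitness [where f' = "\<lambda>j. vec_abs (j - i)"])
      (use inv cl z z' w assms in auto)
qed

end

theory Submission
  imports Defs
begin

text \<open>
  Averaging over the sign twists \<open>z \<mapsto> (-1)\<^sup>s z\<close> turns the bracket of \<open>F = \<Sum> f\<^sub>k z\<^sup>k\<close> and \<open>H\<close> into
  \<open>\<Sum> f\<^sub>k cnj u\<^sub>k\<close>, up to the factor \<open>2\<^sup>d / cnj c\<close>. This makes every \<open>H\<^sub>j\<close> orthogonal to \<open>H\<close>, and
  forces the coefficient of \<open>H\<close> in the expansion of \<open>F\<close> to be \<open>\<langle>F,H\<rangle> / \<langle>H,H\<rangle>\<close>; the other coefficients
  are then read off after dividing by \<open>cnj u\<^sub>i\<close>. If \<open>\<langle>H,H\<rangle>\<close> vanished at a point of the torus, so would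
  all twists of \<open>H\<close>, hence \<open>u\<^sub>i\<close>; thus \<open>\<langle>H,H\<rangle>\<close> is a nowhere vanishing Laurent polynomial.

  Its inverse has absolutely summable coefficients by an elementary case of Wiener's lemma: if
  \<open>\<bar>Q\<bar> \<le> r < 1\<close> on the torus, then the coefficients of \<open>Q\<^sup>n\<close> are bounded by \<open>r\<^sup>n\<close> and their number
  grows only polynomially in \<open>n\<close>, so the geometric series of \<open>Q\<close> converges in \<open>\<ell>\<^sub>1\<close>.
\<close>

section \<open>Monomials and sign twists\<close>

lemma torus_nz: "z \<in> torus \<Longrightarrow> z $ l \<noteq> 0"
  by (auto simp: torus_def dest: spec [of _ l])

lemma norm_monomial: "z \<in> torus \<Longrightarrow> cmod (monomial z k) = 1"
  by (simp add: monomial_def torus_def prod_norm [symmetric] norm_power_int)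

lemma monomial_add: "z \<in> torus \<Longrightarrow> monomial z (k + l) = monomial z k * monomial z l"
  by (simp add: monomial_def power_int_add torus_nz prod.distrib)

lemma monomial_zero [simp]: "monomial z 0 = 1"
  by (simp add: monomial_def)

lemma square_point_torus: "z \<in> torus \<Longrightarrow> square_point z \<in> torus"
  by (simp add: torus_def square_point_def norm_power)

lemma monomial_square_point: "z \<in> torus \<Longrightarrow> monomial (square_point z) k = monomial z (k + k)"
  unfolding monomial_add
  by (simp add: monomial_def square_point_def power2_eq_square power_int_mult_distrib prod.distrib)

lemma sign_twist_torus: "z \<in> torus \<Longrightarrow> sign_twist s z \<in> torus"
  by (simp add: torus_def sign_twist_def norm_mult norm_power_int)

lemma square_point_sign_twist: "square_point (sign_twist s z) = square_point z"
proof -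
  have "((- 1 :: complex) powi m)\<^sup>2 = 1" for m
    by (cases "even m") auto
  then show ?thesis
    by (simp add: square_point_def sign_twist_def power_mult_distrib)
qed

lemma monomial_sign_twist:
  "monomial (sign_twist s z) k = (\<Prod>l\<in>UNIV. (- 1) powi (s $ l * k $ l)) * monomial z k"
  by (simp add: monomial_def sign_twist_def power_int_mult_distrib power_int_mult prod.distrib)

text \<open>Distributivity over coordinatewise index sets, moved from functions to vectors.
  Character sums over \<open>cube\<close> and over grids of roots of unity factor through it into
  one-dimensional sums; constant factors 1 give the size of a box.\<close>

lemma sum_prod_vec:
  fixes f :: "'d::finite \<Rightarrow> 'a \<Rightarrow> 'b::comm_semiring_1"
  assumes "\<And>l. finite (S l)"
  shows "(\<Sum>v | \<forall>l. v $ l \<in> S l. \<Prod>l\<in>UNIV. f l (v $ l)) = (\<Prod>l\<in>UNIV. \<Sum>x\<in>S l. f l x)"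
proof -
  have "(\<Prod>l\<in>UNIV. \<Sum>x\<in>S l. f l x) = (\<Sum>g\<in>PiE UNIV S. \<Prod>l\<in>UNIV. f l (g l))"
    by (rule prod_sum_PiE) (use assms in auto)
  also have "\<dots> = (\<Sum>v | \<forall>l. v $ l \<in> S l. \<Prod>l\<in>UNIV. f l (v $ l))"
    by (rule sum.reindex_bij_witness [where i = vec_nth and j = vec_lambda]) auto
  finally show ?thesis by simp
qed

lemma finite_vec_box:
  assumes "\<And>l. finite (S l)"
  shows "finite {v :: 'a^'d::finite. \<forall>l. v $ l \<in> S l}"
proof (rule finite_subset)
  show "{v. \<forall>l. v $ l \<in> S l} \<subseteq> vec_lambda ` PiE UNIV S"
    by (force simp: image_iff intro!: bexI [where x = "vec_nth _"])
  show "finite (vec_lambda ` PiE UNIV S)"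
    using assms by (intro finite_imageI finite_PiE) auto
qed

lemma card_vec_box:
  assumes "\<And>l. finite (S l)"
  shows "card {v :: 'a^'d::finite. \<forall>l. v $ l \<in> S l} = (\<Prod>l\<in>UNIV. card (S l))"
  using sum_prod_vec [OF assms, of "\<lambda>_ _. 1 :: nat"] by simp

lemma finite_cube [simp]: "finite (cube :: (int^'d::finite) set)"
  unfolding cube_def by (rule finite_vec_box) auto

lemma zero_in_cube [simp]: "0 \<in> cube"
  by (simp add: cube_def)

text \<open>On exponents the twist by \<open>s\<close> acts as the character (-1)^(s.k) of (Z/2)^d,
  so the sum is a product over the coordinates. Different elements of \<open>cube\<close> differ by
  an odd number in some coordinate, and the factor there is 1 + (-1) = 0.\<close>

lemma monomial_orthogonal:
  fixes z :: "complex^'d::finite"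
  assumes z: "z \<in> torus" and k: "k \<in> cube" and l: "l \<in> cube"
  shows "(\<Sum>s\<in>cube. monomial (sign_twist s z) k * cnj (monomial (sign_twist s z) l))
    = (if k = l then 2 ^ CARD('d) else 0)"
proof -
  have "(\<Sum>s\<in>cube. monomial (sign_twist s z) k * cnj (monomial (sign_twist s z) l))
     = (\<Sum>s\<in>cube. monomial (sign_twist s z) (k - l))"
    by (simp add: cnj_monomial sign_twist_torus z monomial_add [symmetric])
  also have "\<dots> = (\<Sum>s\<in>cube. \<Prod>m\<in>UNIV. (- 1) powi (s $ m * (k - l) $ m)) * monomial z (k - l)"
    by (simp add: monomial_sign_twist sum_distrib_right)
  also have "(\<Sum>s\<in>cube. \<Prod>m\<in>UNIV. (- 1) powi (s $ m * (k - l) $ m))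
      = (\<Prod>m\<in>UNIV. \<Sum>x\<in>{0,1::int}. (- 1 :: complex) powi (x * (k - l) $ m))"
    unfolding cube_def by (rule sum_prod_vec) auto
  also have "\<dots> * monomial z (k - l) = (if k = l then 2 ^ CARD('d) else 0)"
  proof (cases "k = l")
    case False
    then obtain m where m: "k $ m \<noteq> l $ m" by (auto simp: vec_eq_iff)
    have "k $ m \<in> {0, 1}" "l $ m \<in> {0, 1}" using k l by (auto simp: cube_def)
    then have "odd (k $ m - l $ m)" using m by auto
    then have "(\<Sum>x\<in>{0,1::int}. (- 1 :: complex) powi (x * (k - l) $ m)) = 0"
      by simp
    then have "(\<Prod>m\<in>UNIV. \<Sum>x\<in>{0,1::int}. (- 1 :: complex) powi (x * (k - l) $ m)) = 0"
      by (intro prod_zero) auto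
    then show ?thesis using False by simp
  qed simp
  finally show ?thesis .
qed

text \<open>Twists compose by addition modulo 2 of their exponents. On {0,1} this addition is |s -
  t|, which for fixed \<open>t\<close> is an involution of \<open>cube\<close>, so the twist by
  \<open>t\<close> only permutes the summands.\<close>

lemma sum_cube_sign_twist:
  fixes z :: "complex^'d::finite"
  assumes t: "t \<in> cube"
  shows "(\<Sum>s\<in>cube. f (sign_twist s (sign_twist t z))) = (\<Sum>s\<in>cube. f (sign_twist s z))"
proof (rule sum.reindex_bij_witness [where i = "\<lambda>s. vec_abs (s - t)" and j = "\<lambda>s. vec_abs (s - t)"])
  fix s :: "int^'d" assume s: "s \<in> cube"
  have st: "s $ l \<in> {0,1}" "t $ l \<in> {0,1}" for l using s t by (auto simp: cube_def)
  show "vec_abs (vec_abs (s - t) - t) = s" 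
    unfolding vec_abs_def vec_eq_iff
  proof
    show "(\<chi> l. \<bar>((\<chi> l. \<bar>(s - t) $ l\<bar>) - t) $ l\<bar>) $ l = s $ l" for l
      using st [of l] by auto
  qed
  show "vec_abs (s - t) \<in> cube"
    unfolding vec_abs_def cube_def mem_Collect_eq
  proof
    show "(\<chi> l. \<bar>(s - t) $ l\<bar>) $ l \<in> {0, 1}" for l
      using st [of l] by auto
  qed
  have "(- 1 :: complex) powi \<bar>s $ l - t $ l\<bar> * z $ l = (- 1) powi (s $ l) * ((- 1) powi (t $ l) * z $ l)" for l
    using st [of l] by auto
  then have "sign_twist (vec_abs (s - t)) z = sign_twist s (sign_twist t z)"
    by (simp only: vec_eq_iff sign_twist_def vec_abs_def vec_lambda_beta vector_minus_component) simp
  then show "f (sign_twist (vec_abs (s - t)) z) = f (sign_twist s (sign_twist t z))"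
    by simp
  show "vec_abs (vec_abs (s - t) - t) = s" "vec_abs (s - t) \<in> cube" by fact+
qed

text \<open>Here \<open>f\<close> and \<open>g\<close> are families of numbers, meant as the values
  at \<open>z\<close> of components that do not change under twists. After both sums are expanded,
  orthogonality of the monomials leaves only the diagonal.\<close>

lemma polyphase_parseval:
  fixes z :: "complex^'d::finite"
  assumes z: "z \<in> torus"
  shows "(\<Sum>s\<in>cube. (\<Sum>k\<in>cube. f k * monomial (sign_twist s z) k)
       * cnj (\<Sum>k\<in>cube. g k * monomial (sign_twist s z) k))
     = 2 ^ CARD('d) * (\<Sum>k\<in>cube. f k * cnj (g k))"
proof -
  have "(\<Sum>s\<in>cube. (\<Sum>k\<in>cube. f k * monomial (sign_twist s z) k)
       * cnj (\<Sum>k\<in>cube. g k * monomial (sign_twist s z) k))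
    = (\<Sum>s\<in>cube. \<Sum>k\<in>cube. \<Sum>l\<in>cube. f k * cnj (g l)
         * (monomial (sign_twist s z) k * cnj (monomial (sign_twist s z) l)))"
    by (simp add: sum_product mult_ac)
  also have "\<dots> = (\<Sum>k\<in>cube. \<Sum>s\<in>cube. \<Sum>l\<in>cube. f k * cnj (g l)
         * (monomial (sign_twist s z) k * cnj (monomial (sign_twist s z) l)))"
    by (rule sum.swap)
  also have "\<dots> = (\<Sum>k\<in>cube. \<Sum>l\<in>cube. \<Sum>s\<in>cube. f k * cnj (g l)
         * (monomial (sign_twist s z) k * cnj (monomial (sign_twist s z) l)))"
    by (intro sum.cong refl sum.swap)
  also have "\<dots> = (\<Sum>k\<in>cube. \<Sum>l\<in>cube. f k * cnj (g l) * (if k = l then 2 ^ CARD('d) else 0))"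
    unfolding sum_distrib_left [symmetric]
    by (intro sum.cong refl) (use z in \<open>simp only: monomial_orthogonal\<close>)
  also have "\<dots> = 2 ^ CARD('d) * (\<Sum>k\<in>cube. f k * cnj (g k))"
    by (simp add: if_distrib sum_distrib_left mult.commute cong: if_cong)
  finally show ?thesis .
qed

section \<open>Laurent polynomials and series as rings of functions\<close>

text \<open>The exponent map \<open>e\<close> need not be injective and \<open>I\<close> is
  arbitrary: terms with the same exponent are collected by Fubini for absolutely summable families.
  Products, conjugates and double series can thus be given over their natural index sets.\<close>

lemma laurent_l1I:
  assumes a: "(\<lambda>x. cmod (a x)) summable_on I"
    and F: "\<And>z. z \<in> torus \<Longrightarrow> F z = (\<Sum>\<^sub>\<infinity>x\<in>I. a x * monomial z (e x))"
  shows "F \<in> laurent_l1"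
proof -
  define R where "R k = {x \<in> I. e x = k}" for k
  define c where "c k = (\<Sum>\<^sub>\<infinity>x\<in>R k. a x)" for k
  \<comment> \<open>The fibres \<open>R k\<close> partition \<open>I\<close>, so a sum over
    \<open>I\<close> becomes an iterated sum, first along each fibre.\<close>
  have bij: "bij_betw snd (Sigma UNIV R) I"
    by (rule bij_betw_byWitness [where f' = "\<lambda>x. (e x, x)"]) (auto simp: R_def)
  have 1: "(\<lambda>p. cmod (a (snd p))) summable_on Sigma UNIV R"
    using a summable_on_reindex_bij_betw [OF bij, of "\<lambda>x. cmod (a x)"] by simp
  then have 2: "(\<lambda>x. cmod (a x)) summable_on R k" "(\<lambda>k. \<Sum>\<^sub>\<infinity>x\<in>R k. cmod (a x)) summable_on UNIV" for k
    using Infinite_Sum.abs_summable_on_Sigma_iff [where f = "\<lambda>p. a (snd p)" and A = UNIV and B = R]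
      summable_on_iff_abs_summable_on_real by auto
  have "(\<lambda>k. cmod (c k)) summable_on UNIV"
    using 2(2) by (rule Infinite_Sum.summable_on_comparison_test)
      (auto simp: c_def intro: norm_infsum_bound 2(1))
  moreover have "F z = (\<Sum>\<^sub>\<infinity>k. c k * monomial z k)" if z: "z \<in> torus" for z
  proof -
    have s: "(\<lambda>p. a (snd p) * monomial z (e (snd p))) summable_on Sigma UNIV R"
      by (rule abs_summable_summable) (use 1 in \<open>simp add: norm_mult norm_monomial z\<close>)
    have "F z = (\<Sum>\<^sub>\<infinity>p\<in>Sigma UNIV R. a (snd p) * monomial z (e (snd p)))"
      using infsum_reindex_bij_betw [OF bij, of "\<lambda>x. a x * monomial z (e x)"] F [OF z] by simp
    also have "\<dots> = (\<Sum>\<^sub>\<infinity>k. \<Sum>\<^sub>\<infinity>x\<in>R k. a x * monomial z (e x))"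
      using infsum_Sigma_banach [OF s] by simp
    also have "\<dots> = (\<Sum>\<^sub>\<infinity>k. \<Sum>\<^sub>\<infinity>x\<in>R k. a x * monomial z k)"
      by (intro infsum_cong) (auto simp: R_def)
    also have "\<dots> = (\<Sum>\<^sub>\<infinity>k. c k * monomial z k)"
      by (simp add: c_def infsum_cmult_left')
    finally show ?thesis .
  qed
  ultimately show ?thesis unfolding laurent_l1_def by blast
qed

lemma laurent_l1E:
  assumes "F \<in> laurent_l1"
  obtains a where "(\<lambda>k. cmod (a k)) summable_on UNIV"
    "\<And>z. z \<in> torus \<Longrightarrow> F z = (\<Sum>\<^sub>\<infinity>k. a k * monomial z k)"
    "\<And>z. z \<in> torus \<Longrightarrow> (\<lambda>k. a k * monomial z k) summable_on UNIV"
proof -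
  obtain a where a: "(\<lambda>k. cmod (a k)) summable_on UNIV"
    "\<And>z. z \<in> torus \<Longrightarrow> F z = (\<Sum>\<^sub>\<infinity>k. a k * monomial z k)"
    using assms unfolding laurent_l1_def by blast
  have "(\<lambda>k. a k * monomial z k) summable_on UNIV" if "z \<in> torus" for z
    by (rule abs_summable_summable) (use a in \<open>simp add: norm_mult norm_monomial that\<close>)
  with a that show thesis by blast
qed

lemma laurent_l1_cong:
  assumes "F \<in> laurent_l1" "\<And>z. z \<in> torus \<Longrightarrow> G z = F z"
  shows "G \<in> laurent_l1"
  using assms unfolding laurent_l1_def by simp

lemma laurent_l1_mult:
  assumes "F \<in> laurent_l1" "G \<in> laurent_l1"
  shows "(\<lambda>z. F z * G z) \<in> laurent_l1"
proof -
  obtain a where a: "(\<lambda>k. cmod (a k)) summable_on UNIV"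
    "\<And>z. z \<in> torus \<Longrightarrow> F z = (\<Sum>\<^sub>\<infinity>k. a k * monomial z k)"
    using assms(1) by (rule laurent_l1E) blast
  obtain b where b: "(\<lambda>k. cmod (b k)) summable_on UNIV"
    "\<And>z. z \<in> torus \<Longrightarrow> G z = (\<Sum>\<^sub>\<infinity>k. b k * monomial z k)"
    using assms(2) by (rule laurent_l1E) blast
  have s: "(\<lambda>p. cmod (a (fst p) * b (snd p))) summable_on UNIV \<times> UNIV"
    using a(1) b(1)
    unfolding Infinite_Sum.abs_summable_on_Sigma_iff
    by (simp add: norm_mult infsum_cmult_right' infsum_nonneg
        summable_on_cmult_right summable_on_cmult_left)
  \<comment> \<open>Collecting the pairs by the sum of their entries is the convolution of
    \<open>a\<close> and \<open>b\<close>.\<close>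
  show ?thesis
  proof (rule laurent_l1I [OF s, where e = "\<lambda>p. fst p + snd p"])
    fix z :: "complex^'a" assume z: "z \<in> torus"
    have s': "(\<lambda>p. (a (fst p) * monomial z (fst p)) * (b (snd p) * monomial z (snd p))) summable_on UNIV \<times> UNIV"
      by (rule abs_summable_summable) (use s in \<open>simp add: norm_mult norm_monomial z\<close>)
    have "(\<Sum>\<^sub>\<infinity>p\<in>UNIV \<times> UNIV. a (fst p) * b (snd p) * monomial z (fst p + snd p))
      = (\<Sum>\<^sub>\<infinity>p\<in>UNIV \<times> UNIV. (a (fst p) * monomial z (fst p)) * (b (snd p) * monomial z (snd p)))"
      by (simp add: monomial_add z mult_ac)
    also have "\<dots> = (\<Sum>\<^sub>\<infinity>k. \<Sum>\<^sub>\<infinity>l. (a k * monomial z k) * (b l * monomial z l))"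
      using infsum_Sigma_banach [OF s'] by simp
    also have "\<dots> = F z * G z"
      by (simp only: infsum_cmult_right' infsum_cmult_left' a(2) b(2) z)
    finally show "F z * G z = (\<Sum>\<^sub>\<infinity>p\<in>UNIV \<times> UNIV. a (fst p) * b (snd p) * monomial z (fst p + snd p))"
      by simp
  qed
qed

lemma laurent_l1_add:
  assumes "F \<in> laurent_l1" "G \<in> laurent_l1"
  shows "(\<lambda>z. F z + G z) \<in> laurent_l1"
proof -
  obtain a where a: "(\<lambda>k. cmod (a k)) summable_on UNIV"
    "\<And>z. z \<in> torus \<Longrightarrow> F z = (\<Sum>\<^sub>\<infinity>k. a k * monomial z k)"
    "\<And>z. z \<in> torus \<Longrightarrow> (\<lambda>k. a k * monomial z k) summable_on UNIV"
    using assms(1) by (rule laurent_l1E) blast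
  obtain b where b: "(\<lambda>k. cmod (b k)) summable_on UNIV"
    "\<And>z. z \<in> torus \<Longrightarrow> G z = (\<Sum>\<^sub>\<infinity>k. b k * monomial z k)"
    "\<And>z. z \<in> torus \<Longrightarrow> (\<lambda>k. b k * monomial z k) summable_on UNIV"
    using assms(2) by (rule laurent_l1E) blast
  have s: "(\<lambda>k. cmod (a k + b k)) summable_on UNIV"
    using summable_on_add [OF a(1) b(1)]
    by (rule Infinite_Sum.summable_on_comparison_test) (auto intro: norm_triangle_ineq)
  show ?thesis
    by (rule laurent_l1I [OF s, where e = id])
      (simp add: a b distrib_right infsum_add)
qed

lemma laurent_l1_cnj:
  assumes "F \<in> laurent_l1"
  shows "(\<lambda>z. cnj (F z)) \<in> laurent_l1"
proof -
  obtain a where a: "(\<lambda>k. cmod (a k)) summable_on UNIV"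
    "\<And>z. z \<in> torus \<Longrightarrow> F z = (\<Sum>\<^sub>\<infinity>k. a k * monomial z k)"
    using assms by (rule laurent_l1E) blast
  show ?thesis
    by (rule laurent_l1I [where a = "\<lambda>k. cnj (a k)" and e = uminus and I = UNIV])
      (use a in \<open>simp_all add: cnj_laurent_series\<close>)
qed

lemma laurent_l1_sign_twist:
  assumes "F \<in> laurent_l1"
  shows "(\<lambda>z. F (sign_twist s z)) \<in> laurent_l1"
proof -
  obtain a where a: "(\<lambda>k. cmod (a k)) summable_on UNIV"
    "\<And>z. z \<in> torus \<Longrightarrow> F z = (\<Sum>\<^sub>\<infinity>k. a k * monomial z k)"
    using assms by (rule laurent_l1E) blast
  show ?thesis
    by (rule laurent_l1I [where e = id and I = UNIV
          and a = "\<lambda>k. a k * (\<Prod>l\<in>UNIV. (- 1) powi (s $ l * k $ l))"])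
      (use a in \<open>simp_all add: sign_twist_torus monomial_sign_twist norm_mult mult_ac
          prod_norm [symmetric] norm_power_int\<close>)
qed

text \<open>Degree bookkeeping for powers. Coefficients may vanish inside the box, so no exact
  degree is involved; what counts is the number of available exponents.\<close>

definition laurent_polys_upto :: "nat \<Rightarrow> (complex^'d::finite \<Rightarrow> complex) set" where
  "laurent_polys_upto N = {F. \<exists>a. \<forall>z\<in>torus.
     F z = (\<Sum>k | \<forall>l. k $ l \<in> {- int N..int N}. a k * monomial z k)}"

lemma finite_exponent_box: "finite {k :: int^'d::finite. \<forall>l. k $ l \<in> {- int N..int N}}"
  by (rule finite_vec_box) simp

lemma laurent_polysI:
  assumes K: "finite K" and F: "\<And>z. z \<in> torus \<Longrightarrow> F z = (\<Sum>k\<in>K. a k * monomial z k)"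
  shows "F \<in> laurent_polys"
proof -
  define b where "b k = (if k \<in> K then a k else 0)" for k
  have sub: "{k. b k \<noteq> 0} \<subseteq> K" by (auto simp: b_def)
  have "F z = (\<Sum>k | b k \<noteq> 0. b k * monomial z k)" if "z \<in> torus" for z
    unfolding F [OF that]
    by (rule sum.mono_neutral_cong_right [OF K sub]) (auto simp: b_def)
  with finite_subset [OF sub K] show ?thesis unfolding laurent_polys_def by blast
qed

lemma laurent_polys_iff_upto: "F \<in> laurent_polys \<longleftrightarrow> (\<exists>N. F \<in> laurent_polys_upto N)"
proof
  assume "F \<in> laurent_polys"
  then obtain a where a: "finite {k. a k \<noteq> 0}"
    "\<And>z. z \<in> torus \<Longrightarrow> F z = (\<Sum>k | a k \<noteq> 0. a k * monomial z k)"
    unfolding laurent_polys_def by blast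
  \<comment> \<open>The sum of all |k_l| over the support is a crude common bound; unlike a maximum
    it also makes sense for an empty support.\<close>
  define N where "N = nat (\<Sum>k | a k \<noteq> 0. \<Sum>l\<in>UNIV. \<bar>k $ l\<bar>)"
  have "\<bar>k $ l\<bar> \<le> int N" if "a k \<noteq> 0" for k l
  proof -
    have "\<bar>k $ l\<bar> \<le> (\<Sum>l\<in>UNIV. \<bar>k $ l\<bar>)"
      by (rule member_le_sum) auto
    also have "\<dots> \<le> (\<Sum>k | a k \<noteq> 0. \<Sum>l\<in>UNIV. \<bar>k $ l\<bar>)"
      using a(1) that by (intro member_le_sum) (auto intro: sum_nonneg)
    finally show ?thesis unfolding N_def by linarith
  qed
  then have "{k. a k \<noteq> 0} \<subseteq> {k. \<forall>l. k $ l \<in> {- int N..int N}}"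
    by (simp add: subset_iff abs_le_iff minus_le_iff)
  then have "F z = (\<Sum>k | \<forall>l. k $ l \<in> {- int N..int N}. a k * monomial z k)" if "z \<in> torus" for z
    unfolding a(2) [OF that] by (rule sum.mono_neutral_left [OF finite_exponent_box]) auto
  then show "\<exists>N. F \<in> laurent_polys_upto N"
    unfolding laurent_polys_upto_def by blast
next
  show "F \<in> laurent_polys" if "\<exists>N. F \<in> laurent_polys_upto N"
    using that laurent_polysI [OF finite_exponent_box] unfolding laurent_polys_upto_def by blast
qed

text \<open>Box sizes add, so the n-th power of a polynomial in the box of size N lives in the box
  of size n * N, whose number of exponents is polynomial in n.\<close>

lemma laurent_polys_upto_mult:
  assumes "F \<in> laurent_polys_upto M" "G \<in> laurent_polys_upto N"
  shows "(\<lambda>z. F z * G z) \<in> laurent_polys_upto (M + N)"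
proof -
  define B where "B n = {k :: int^'a. \<forall>l. k $ l \<in> {- int n..int n}}" for n
  have fin: "finite (B n)" for n unfolding B_def by (rule finite_exponent_box)
  obtain a b where a: "\<And>z. z \<in> torus \<Longrightarrow> F z = (\<Sum>k\<in>B M. a k * monomial z k)"
    and b: "\<And>z. z \<in> torus \<Longrightarrow> G z = (\<Sum>k\<in>B N. b k * monomial z k)"
    using assms unfolding laurent_polys_upto_def B_def by blast
  define c where "c m = (\<Sum>p | p \<in> B M \<times> B N \<and> fst p + snd p = m. a (fst p) * b (snd p))" for m
  have sub: "(\<lambda>p. fst p + snd p) ` (B M \<times> B N) \<subseteq> B (M + N)"
    by (auto simp: B_def intro: add_mono)
      (metis add.commute add_mono minus_add_distrib add_uminus_conv_diff)+
  have "F z * G z = (\<Sum>m\<in>B (M + N). c m * monomial z m)" if z: "z \<in> torus" for z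
  proof -
    have "F z * G z = (\<Sum>p\<in>B M \<times> B N. a (fst p) * b (snd p) * monomial z (fst p + snd p))"
      by (simp add: a b z sum_product sum.cartesian_product monomial_add case_prod_unfold mult_ac)
    also have "\<dots> = (\<Sum>m\<in>B (M + N). \<Sum>p | p \<in> B M \<times> B N \<and> fst p + snd p = m.
        a (fst p) * b (snd p) * monomial z (fst p + snd p))"
      using fin sub by (intro sum.group [symmetric]) auto
    also have "\<dots> = (\<Sum>m\<in>B (M + N). c m * monomial z m)"
      by (auto simp: c_def sum_distrib_right intro!: sum.cong)
    finally show ?thesis .
  qed
  then show ?thesis unfolding laurent_polys_upto_def B_def by blast
qed

lemma laurent_polys_mult:
  "F \<in> laurent_polys \<Longrightarrow> G \<in> laurent_polys \<Longrightarrow> (\<lambda>z. F z * G z) \<in> laurent_polys"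
  using laurent_polys_upto_mult unfolding laurent_polys_iff_upto by blast

lemma laurent_polys_const: "(\<lambda>z. c) \<in> laurent_polys"
  by (rule laurent_polysI [of "{0}" _ "\<lambda>_. c"]) auto

lemma laurent_polys_monomial: "(\<lambda>z. monomial z k) \<in> laurent_polys"
  by (rule laurent_polysI [of "{k}" _ "\<lambda>_. 1"]) auto

lemma laurent_polysE:
  assumes "F \<in> laurent_polys"
  obtains K a where "finite K" "\<And>z. z \<in> torus \<Longrightarrow> F z = (\<Sum>k\<in>K. a k * monomial z k)"
  using assms unfolding laurent_polys_def by blast

lemma laurent_polys_add:
  assumes "F \<in> laurent_polys" "G \<in> laurent_polys"
  shows "(\<lambda>z. F z + G z) \<in> laurent_polys"
proof -
  obtain a where a: "finite {k. a k \<noteq> 0}"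
    "\<And>z. z \<in> torus \<Longrightarrow> F z = (\<Sum>k | a k \<noteq> 0. a k * monomial z k)"
    using assms(1) unfolding laurent_polys_def by blast
  obtain b where b: "finite {k. b k \<noteq> 0}"
    "\<And>z. z \<in> torus \<Longrightarrow> G z = (\<Sum>k | b k \<noteq> 0. b k * monomial z k)"
    using assms(2) unfolding laurent_polys_def by blast
  show ?thesis
  proof (rule laurent_polysI [where a = "\<lambda>k. a k + b k"])
    show fin: "finite ({k. a k \<noteq> 0} \<union> {k. b k \<noteq> 0})" using a b by simp
    fix z :: "complex^'a" assume z: "z \<in> torus"
    have "F z = (\<Sum>k\<in>{k. a k \<noteq> 0} \<union> {k. b k \<noteq> 0}. a k * monomial z k)"
      unfolding a(2) [OF z] by (rule sum.mono_neutral_left [OF fin]) auto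
    moreover have "G z = (\<Sum>k\<in>{k. a k \<noteq> 0} \<union> {k. b k \<noteq> 0}. b k * monomial z k)"
      unfolding b(2) [OF z] by (rule sum.mono_neutral_left [OF fin]) auto
    ultimately show "F z + G z = (\<Sum>k\<in>{k. a k \<noteq> 0} \<union> {k. b k \<noteq> 0}. (a k + b k) * monomial z k)"
      by (simp add: distrib_right sum.distrib)
  qed
qed

lemma laurent_polys_sum:
  "finite I \<Longrightarrow> (\<And>i. i \<in> I \<Longrightarrow> F i \<in> laurent_polys) \<Longrightarrow> (\<lambda>z. \<Sum>i\<in>I. F i z) \<in> laurent_polys"
  by (induction I rule: finite_induct) (auto intro: laurent_polys_add laurent_polys_const)

lemma laurent_polys_diff:
  "F \<in> laurent_polys \<Longrightarrow> G \<in> laurent_polys \<Longrightarrow> (\<lambda>z. F z - G z) \<in> laurent_polys"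
  using laurent_polys_add [OF _ laurent_polys_mult [OF laurent_polys_const [of "- 1"]], of F G]
  by simp

lemma laurent_polys_cong:
  assumes "F \<in> laurent_polys" "\<And>z. z \<in> torus \<Longrightarrow> G z = F z"
  shows "G \<in> laurent_polys"
  using assms unfolding laurent_polys_def by simp

lemma laurent_polys_cnj:
  assumes "F \<in> laurent_polys"
  shows "(\<lambda>z. cnj (F z)) \<in> laurent_polys"
proof -
  obtain K a where K: "finite K" and F: "\<And>z. z \<in> torus \<Longrightarrow> F z = (\<Sum>k\<in>K. a k * monomial z k)"
    using assms by (rule laurent_polysE) blast
  have "(\<lambda>z. \<Sum>k\<in>K. cnj (a k) * monomial z (- k)) \<in> laurent_polys"
    by (intro laurent_polys_sum laurent_polys_mult laurent_polys_const laurent_polys_monomial K)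
  then show ?thesis
    by (rule laurent_polys_cong) (simp add: F cnj_monomial)
qed

lemma laurent_polys_sign_twist:
  assumes "F \<in> laurent_polys"
  shows "(\<lambda>z. F (sign_twist s z)) \<in> laurent_polys"
proof -
  obtain K a where K: "finite K" and F: "\<And>z. z \<in> torus \<Longrightarrow> F z = (\<Sum>k\<in>K. a k * monomial z k)"
    using assms by (rule laurent_polysE) blast
  show ?thesis
    by (rule laurent_polysI [OF K, where a = "\<lambda>k. a k * (\<Prod>l\<in>UNIV. (- 1) powi (s $ l * k $ l))"])
      (simp add: F sign_twist_torus monomial_sign_twist mult_ac)
qed

lemma laurent_polys_imp_l1:
  assumes "F \<in> laurent_polys"
  shows "F \<in> laurent_l1"
proof -
  obtain K a where K: "finite K" and F: "\<And>z. z \<in> torus \<Longrightarrow> F z = (\<Sum>k\<in>K. a k * monomial z k)"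
    using assms by (rule laurent_polysE) blast
  show ?thesis
    by (rule laurent_l1I [where a = a and I = K and e = id]) (use K in \<open>auto simp: F\<close>)
qed

section \<open>Inverses of Laurent polynomials\<close>

text \<open>The bound on \<open>j\<close> excludes nonzero multiples of \<open>m\<close>. For j
  \<noteq> 0 the summands are therefore the powers of some w \<noteq> 1 with w^m = 1, and the
  geometric sum vanishes.\<close>

lemma sum_cis_roots_unity:
  assumes m: "m > 0" and j: "\<bar>j\<bar> < int m"
  shows "(\<Sum>t<m. cis (2 * pi * real t / real m) powi j) = (if j = 0 then of_nat m else 0)"
proof (cases "j = 0")
  case False
  define w where "w = cis (2 * pi * of_int j / real m)"
  have 1: "cis (2 * pi * real t / real m) powi j = w ^ t" for t
    unfolding w_def cis_power_int Complex.DeMoivre by (rule arg_cong [of _ _ cis]) simp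
  have "w \<noteq> 1"
  proof
    assume "w = 1"
    then have "cos (2 * pi * of_int j / real m) = 1"
      unfolding w_def by (metis cis.sel(1) one_complex.sel(1))
    then obtain n :: int where "2 * pi * of_int j / real m = of_int n * 2 * pi"
      unfolding cos_one_2pi_int by blast
    then have "of_int j = (of_int n * real m :: real)" using m by (simp add: field_simps)
    then have "j = n * int m" by (metis of_int_eq_iff of_int_mult of_int_of_nat_eq)
    with j m False show False by (auto simp: abs_mult)
  qed
  moreover have "w ^ m = 1"
    using m cis_multiple_2pi [of "of_int j"] by (simp add: w_def Complex.DeMoivre)
  ultimately show ?thesis using False
    by (simp add: 1 sum_gp_strict)
qed simp

lemma laurent_coeff_bound:
  fixes F :: "complex^'d::finite \<Rightarrow> complex"
  assumes F: "\<And>z. z \<in> torus \<Longrightarrow>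
      F z = (\<Sum>k | \<forall>l. k $ l \<in> {- int N..int N}. a k * monomial z k)"
    and bd: "\<And>z. z \<in> torus \<Longrightarrow> cmod (F z) \<le> r"
    and k: "\<forall>l. k $ l \<in> {- int N..int N}"
  shows "cmod (a k) \<le> r"
proof -
  \<comment> \<open>A mean over the \<open>(2N+1)\<close>-th roots of unity already separates the exponents in the box, so no
    integration over the torus is needed.\<close>
  define m where "m = 2 * N + 1"
  define T where "T = {t :: nat^'d. \<forall>l. t $ l \<in> {..<m}}"
  define \<zeta> where "\<zeta> t = (\<chi> l. cis (2 * pi * real (t $ l) / real m))" for t :: "nat^'d"
  define B where "B = {k :: int^'d. \<forall>l. k $ l \<in> {- int N..int N}}"
  have finB: "finite B" unfolding B_def by (rule finite_exponent_box)
  have \<zeta>: "\<zeta> t \<in> torus" for t by (simp add: \<zeta>_def torus_def)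
  have cardT: "card T = m ^ CARD('d)"
    unfolding T_def by (subst card_vec_box) auto
  have orth: "(\<Sum>t\<in>T. monomial (\<zeta> t) (n - k)) = (if n = k then of_nat (card T) else 0)" if "n \<in> B" for n
  proof -
    have "(\<Sum>t\<in>T. monomial (\<zeta> t) (n - k))
       = (\<Prod>l\<in>UNIV. \<Sum>t<m. cis (2 * pi * real t / real m) powi ((n - k) $ l))"
      unfolding T_def monomial_def \<zeta>_def
      by (subst sum_prod_vec [symmetric]) auto
    also have "\<dots> = (\<Prod>l\<in>UNIV. if (n - k) $ l = 0 then of_nat m else 0)"
    proof (intro prod.cong refl sum_cis_roots_unity)
      fix l
      \<comment> \<open>Two exponents in the box differ by at most 2N in each coordinate, one less
        than \<open>m\<close>, so no aliasing occurs.\<close>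
      have "n $ l \<in> {- int N..int N}" "k $ l \<in> {- int N..int N}"
        using that k by (auto simp: B_def)
      then show "\<bar>(n - k) $ l\<bar> < int m" unfolding m_def by auto
    qed (simp add: m_def)
    also have "\<dots> = (if n = k then of_nat (card T) else 0)"
    proof (cases "n = k")
      case False
      then obtain l where "n $ l \<noteq> k $ l" by (auto simp: vec_eq_iff)
      then show ?thesis using False by (auto intro!: prod_zero)
    qed (simp add: cardT)
    finally show ?thesis .
  qed
  \<comment> \<open>Shifting by -k moves the wanted coefficient to the exponent 0, the only one that
    the mean keeps.\<close>
  have "(\<Sum>t\<in>T. F (\<zeta> t) * monomial (\<zeta> t) (- k)) = (\<Sum>t\<in>T. \<Sum>n\<in>B. a n * monomial (\<zeta> t) (n - k))"
    by (simp only: F \<zeta> B_def [symmetric] sum_distrib_right mult.assoc monomial_add [symmetric]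
        add_uminus_conv_diff)
  also have "\<dots> = (\<Sum>n\<in>B. a n * (\<Sum>t\<in>T. monomial (\<zeta> t) (n - k)))"
    unfolding sum_distrib_left by (rule sum.swap)
  also have "\<dots> = (\<Sum>n\<in>B. a n * (if n = k then of_nat (card T) else 0))"
    by (intro sum.cong refl) (simp only: orth)
  also have "\<dots> = a k * of_nat (card T)"
    using k finB by (simp add: if_distrib B_def cong: if_cong)
  finally have "cmod (a k) * card T = cmod (\<Sum>t\<in>T. F (\<zeta> t) * monomial (\<zeta> t) (- k))"
    by (simp add: norm_mult)
  also have "\<dots> \<le> of_nat (card T) * r"
    by (rule sum_norm_bound) (simp add: norm_mult norm_monomial \<zeta> bd)
  finally show ?thesis
    using cardT by (simp add: m_def)
qed

text \<open>The ratio test is applied to f(n) / f(n+1), whose limit is 1/r > 1. In the application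
  \<open>d\<close> is the dimension, the growth exponent of the number of coefficients of the n-th
  power.\<close>

lemma summable_poly_geometric:
  fixes r :: real
  assumes "0 < r" "r < 1"
  shows "summable (\<lambda>n. real (n + 1) ^ d * r ^ n)"
proof -
  have "(\<lambda>n. (real (Suc n) / real (Suc (Suc n))) ^ d / r) \<longlonglongrightarrow> 1 ^ d / r"
    using assms LIMSEQ_Suc [OF LIMSEQ_n_over_Suc_n] by (intro tendsto_intros) auto
  then have "(\<lambda>n. ereal ((real (Suc n) / real (Suc (Suc n))) ^ d / r)) \<longlonglongrightarrow> ereal (1 / r)"
    by simp
  then have "liminf (\<lambda>n. ereal ((real (Suc n) / real (Suc (Suc n))) ^ d / r)) = ereal (1 / r)"
    by (rule lim_imp_Liminf [OF trivial_limit_sequentially])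
  moreover have "real (n + 1) ^ d * r ^ n / (real (Suc n + 1) ^ d * r ^ Suc n)
      = (real (Suc n) / real (Suc (Suc n))) ^ d / r" for n
    using assms by (simp add: power_divide field_simps)
  ultimately show ?thesis
    using assms by (intro ratio_test_convergence) (simp_all del: of_nat_Suc)
qed

text \<open>The coefficients of all powers of \<open>Q\<close> form one family indexed by pairs (n,
  k). Once this family is absolutely summable, the same double series sums by powers to 1 / (1 - Q)
  and by exponents to a Laurent series.\<close>

lemma laurent_l1_geometric:
  assumes Q: "Q \<in> laurent_polys" and r: "0 < r" "r < 1"
    and bd: "\<And>z. z \<in> torus \<Longrightarrow> cmod (Q z) \<le> r"
  shows "(\<lambda>z. 1 / (1 - Q z)) \<in> laurent_l1"
proof -
  obtain N where N: "Q \<in> laurent_polys_upto N" using Q laurent_polys_iff_upto by blast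
  define B where "B n = {k :: int^'a. \<forall>l. k $ l \<in> {- int (n * N)..int (n * N)}}" for n
  have finB: "finite (B n)" for n unfolding B_def by (rule finite_exponent_box)
  have "(\<lambda>z. Q z ^ n) \<in> laurent_polys_upto (n * N)" for n
  proof (induction n)
    case 0
    \<comment> \<open>For n = 0 the box is the single exponent 0, and the constant 1 is its
      monomial.\<close>
    have "{k :: int^'a. \<forall>l. k $ l = 0} = {0}" by (auto simp: vec_eq_iff)
    then show ?case
      by (auto simp: laurent_polys_upto_def intro!: exI [of _ "\<lambda>_. 1"])
  next
    case (Suc n)
    show ?case using laurent_polys_upto_mult [OF N Suc] by simp
  qed
  then have "\<exists>b. \<forall>z\<in>torus. Q z ^ n = (\<Sum>k\<in>B n. b k * monomial z k)" for n
    unfolding laurent_polys_upto_def B_def by blast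
  then obtain b where b: "\<And>n z. z \<in> torus \<Longrightarrow> Q z ^ n = (\<Sum>k\<in>B n. b n k * monomial z k)"
    by metis
  \<comment> \<open>The bound passes from the values of \<open>Q\<close> to those of its power and
    only then to the coefficients; the absolute coefficient sum of \<open>Q\<close> itself may
    exceed 1.\<close>
  have bb: "cmod (b n k) \<le> r ^ n" if "k \<in> B n" for n k
  proof (rule laurent_coeff_bound)
    show "Q z ^ n = (\<Sum>k | \<forall>l. k $ l \<in> {- int (n * N)..int (n * N)}. b n k * monomial z k)"
      if "z \<in> torus" for z using b [OF that] unfolding B_def .
    show "cmod (Q z ^ n) \<le> r ^ n" if "z \<in> torus" for z
      by (simp add: norm_power power_mono bd that)
  qed (use that in \<open>simp add: B_def\<close>)
  have cardB: "real (card (B n)) \<le> real (2 * N + 1) ^ CARD('a) * real (n + 1) ^ CARD('a)" for n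
  proof -
    have "card (B n) = (2 * (n * N) + 1) ^ CARD('a)"
      unfolding B_def by (subst card_vec_box) (auto simp: nat_add_distrib nat_mult_distrib mult.commute)
    \<comment> \<open>This separates a constant from the dependence on n.\<close>
    also have "\<dots> \<le> ((2 * N + 1) * (n + 1)) ^ CARD('a)"
      by (rule power_mono) (auto simp: algebra_simps)
    finally show ?thesis
      by (simp only: power_mult_distrib flip: of_nat_mult of_nat_power)
  qed
  define C where "C = real (2 * N + 1) ^ CARD('a)"
  have "summable (\<lambda>n. C * (real (n + 1) ^ CARD('a) * r ^ n))"
    using r by (intro summable_mult summable_poly_geometric)
  then have "(\<lambda>n. C * (real (n + 1) ^ CARD('a) * r ^ n)) summable_on UNIV"
    using r by (subst summable_on_UNIV_nonneg_real_iff) (auto simp: C_def)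
  then have "(\<lambda>n. \<Sum>k\<in>B n. cmod (b n k)) summable_on UNIV"
  proof (rule Infinite_Sum.summable_on_comparison_test)
    fix n
    have "(\<Sum>k\<in>B n. cmod (b n k)) \<le> real (card (B n)) * r ^ n"
      by (rule sum_bounded_above) (rule bb)
    also have "\<dots> \<le> C * real (n + 1) ^ CARD('a) * r ^ n"
      unfolding C_def using r cardB by (intro mult_right_mono) auto
    finally show "(\<Sum>k\<in>B n. cmod (b n k)) \<le> C * (real (n + 1) ^ CARD('a) * r ^ n)"
      by (simp add: mult.assoc)
  qed (auto intro: sum_nonneg)
  then have s: "(\<lambda>p. cmod (b (fst p) (snd p))) summable_on Sigma UNIV B"
    unfolding Infinite_Sum.abs_summable_on_Sigma_iff by (simp add: finB abs_of_nonneg sum_nonneg)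
  show ?thesis
  proof (rule laurent_l1I [OF s, where e = snd])
    fix z :: "complex^'a" assume z: "z \<in> torus"
    have s': "(\<lambda>p. b (fst p) (snd p) * monomial z (snd p)) summable_on Sigma UNIV B"
      by (rule abs_summable_summable) (use s in \<open>simp add: norm_mult norm_monomial z\<close>)
    have q: "cmod (Q z) < 1" using bd [OF z] r by simp
    have "((\<lambda>n. Q z ^ n) has_sum 1 / (1 - Q z)) UNIV"
      using q by (intro norm_summable_imp_has_sum geometric_sums)
        (simp_all add: norm_power summable_geometric)
    then have "1 / (1 - Q z) = (\<Sum>\<^sub>\<infinity>n. Q z ^ n)"
      by (simp add: infsumI)
    also have "\<dots> = (\<Sum>\<^sub>\<infinity>n. \<Sum>\<^sub>\<infinity>k\<in>B n. b n k * monomial z k)"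
      by (simp add: b [OF z] finB)
    also have "\<dots> = (\<Sum>\<^sub>\<infinity>p\<in>Sigma UNIV B. b (fst p) (snd p) * monomial z (snd p))"
      using infsum_Sigma_banach [OF s'] by simp
    finally show "1 / (1 - Q z) = (\<Sum>\<^sub>\<infinity>p\<in>Sigma UNIV B. b (fst p) (snd p) * monomial z (snd p))" .
  qed
qed

lemma compact_torus: "compact (torus :: (complex^'d::finite) set)"
proof (rule compact_eq_bounded_closed [THEN iffD2], intro conjI)
  show "bounded (torus :: (complex^'d) set)"
    unfolding bounded_iff
  proof (intro exI ballI)
    fix z :: "complex^'d" assume "z \<in> torus"
    then show "norm z \<le> real CARD('d)"
      using L2_set_le_sum [of UNIV "\<lambda>l. norm (z $ l)"] by (simp add: norm_vec_def torus_def)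
  qed
  have "closed (\<Inter>l. {z :: complex^'d. cmod (z $ l) = 1})"
    by (intro closed_INT ballI closed_Collect_eq continuous_intros)
  moreover have "torus = (\<Inter>l. {z :: complex^'d. cmod (z $ l) = 1})"
    by (auto simp: torus_def)
  ultimately show "closed (torus :: (complex^'d) set)"
    by metis
qed

lemma one_in_torus: "1 \<in> torus"
  by (simp add: torus_def)

lemma continuous_on_laurent_poly:
  assumes "F \<in> laurent_polys"
  shows "continuous_on torus F"
proof -
  obtain K a where K: "finite K" and F: "\<And>z. z \<in> torus \<Longrightarrow> F z = (\<Sum>k\<in>K. a k * monomial z k)"
    using assms by (rule laurent_polysE) blast
  have "continuous_on torus (\<lambda>z :: complex^'a. \<Sum>k\<in>K. a k * monomial z k)"
    unfolding monomial_def by (intro continuous_intros) (auto simp: torus_nz)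
  then show ?thesis by (simp add: F cong: continuous_on_cong)
qed

text \<open>The values of \<open>P\<close> may surround 0, so a geometric series does not apply
  directly. But \<open>W\<close>, equal to P * cnj P, is again a Laurent polynomial, and compactness
  of the torus keeps it between positive bounds; scaled into (0,1) it becomes 1 - Q. Finally 1 / P =
  cnj P / W.\<close>

lemma laurent_poly_inverse:
  assumes P: "P \<in> laurent_polys" and nz: "\<And>z. z \<in> torus \<Longrightarrow> P z \<noteq> 0"
  shows "(\<lambda>z. 1 / P z) \<in> laurent_l1"
proof -
  define W where "W z = (cmod (P z))\<^sup>2" for z
  have cont: "continuous_on torus W"
    unfolding W_def by (intro continuous_intros continuous_on_laurent_poly P)
  have ne: "torus \<noteq> {}" using one_in_torus by blast
  obtain x where x: "x \<in> torus" "\<And>z. z \<in> torus \<Longrightarrow> W x \<le> W z"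
    using continuous_attains_inf [OF compact_torus ne cont] by blast
  obtain y where y: "y \<in> torus" "\<And>z. z \<in> torus \<Longrightarrow> W z \<le> W y"
    using continuous_attains_sup [OF compact_torus ne cont] by blast
  \<comment> \<open>Adding 1 makes 1 - W x / M strictly positive even if |P| is constant on the
    torus; the geometric lemma asks for 0 < r.\<close>
  define M where "M = W y + 1"
  have Wx: "0 < W x" using nz [OF x(1)] by (simp add: W_def)
  have xM: "W x < M" using y(2) [OF x(1)] by (simp add: M_def)
  have M: "M > 0" using Wx xM by simp
  define Q where "Q z = 1 - complex_of_real (W z / M)" for z :: "complex^'a"
  have Q_eq: "Q z = 1 - of_real (1 / M) * (P z * cnj (P z))" for z
    by (simp add: Q_def W_def complex_norm_square [symmetric])
  have "Q \<in> laurent_polys"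
    unfolding Q_eq [abs_def]
    by (intro laurent_polys_diff laurent_polys_const laurent_polys_mult laurent_polys_cnj P)
  then have "(\<lambda>z. 1 / (1 - Q z)) \<in> laurent_l1"
  proof (rule laurent_l1_geometric)
    show "0 < 1 - W x / M" "1 - W x / M < 1" using Wx xM M by simp_all
    fix z :: "complex^'a" assume z: "z \<in> torus"
    have "cmod (Q z) = \<bar>1 - W z / M\<bar>"
      unfolding Q_def by (metis norm_of_real of_real_1 of_real_diff)
    also have "\<dots> \<le> 1 - W x / M"
      using x(2) [OF z] y(2) [OF z] M by (simp add: abs_le_iff divide_right_mono M_def)
    finally show "cmod (Q z) \<le> 1 - W x / M" .
  qed
  then have "(\<lambda>z. of_real (1 / M) * cnj (P z) * (1 / (1 - Q z))) \<in> laurent_l1"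
    by (rule laurent_l1_mult [rotated])
      (intro laurent_polys_imp_l1 laurent_polys_mult laurent_polys_const laurent_polys_cnj P)
  then show ?thesis
    by (rule laurent_l1_cong) (use nz M in \<open>simp add: Q_eq\<close>)
qed

section \<open>The subring of series in squares and polyphase components\<close>

lemma laurent_l1_down_imp_l1:
  assumes "F \<in> laurent_l1_down"
  shows "F \<in> laurent_l1"
proof -
  obtain P where P: "P \<in> laurent_l1" "\<And>z. z \<in> torus \<Longrightarrow> F z = P (square_point z)"
    using assms unfolding laurent_l1_down_def by blast
  obtain a where a: "(\<lambda>k. cmod (a k)) summable_on UNIV"
    "\<And>z. z \<in> torus \<Longrightarrow> P z = (\<Sum>\<^sub>\<infinity>k. a k * monomial z k)"
    using P(1) by (rule laurent_l1E) blast
  show ?thesis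
    by (rule laurent_l1I [OF a(1), where e = "\<lambda>k. k + k"])
      (simp add: P(2) a(2) square_point_torus monomial_square_point)
qed

lemma laurent_l1_down_sign_twist:
  assumes "F \<in> laurent_l1_down" "z \<in> torus"
  shows "F (sign_twist s z) = F z"
  using assms unfolding laurent_l1_down_def
  by (auto simp: sign_twist_torus square_point_sign_twist)

text \<open>Every integer vector is 2m + k for exactly one k in \<open>cube\<close>, its residue
  modulo 2. The absolutely convergent series is grouped by these 2^d cosets.\<close>

lemma polyphase_decomposition:
  fixes F :: "complex^'d::finite \<Rightarrow> complex"
  assumes "F \<in> laurent_l1"
  obtains f where "\<And>k. f k \<in> laurent_l1_down"
    "\<And>z. z \<in> torus \<Longrightarrow> F z = (\<Sum>k\<in>cube. f k z * monomial z k)"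
proof -
  obtain a where a: "(\<lambda>k. cmod (a k)) summable_on UNIV"
    "\<And>z. z \<in> torus \<Longrightarrow> F z = (\<Sum>\<^sub>\<infinity>k. a k * monomial z k)"
    "\<And>z. z \<in> torus \<Longrightarrow> (\<lambda>k. a k * monomial z k) summable_on UNIV"
    using assms by (rule laurent_l1E) blast
  \<comment> \<open>\<open>P k\<close> carries the coefficients on the coset of \<open>k\<close>; at
    the squared point its exponent m turns into m + m.\<close>
  define P where "P k z = (\<Sum>\<^sub>\<infinity>m. a (m + m + k) * monomial z m)" for k and z :: "complex^'d"
  have inj: "inj (\<lambda>m. m + m + k)" for k :: "int^'d"
    by (auto simp: inj_def vec_eq_iff)
  have s: "(\<lambda>m. cmod (a (m + m + k))) summable_on UNIV" for k
    using summable_on_reindex [OF inj, of "\<lambda>k. cmod (a k)"] summable_on_subset_banach [OF a(1)]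
    by (simp add: o_def)
  have P: "P k \<in> laurent_l1" for k
    by (rule laurent_l1I [OF s, where e = id]) (simp add: P_def)
  have bij: "bij_betw (\<lambda>p. snd p + snd p + fst p) (cube \<times> UNIV) (UNIV :: (int^'d) set)"
  proof (rule bij_betw_byWitness [where f' = "\<lambda>n. (\<chi> l. n $ l mod 2, \<chi> l. n $ l div 2)"])
    show "\<forall>p\<in>cube \<times> UNIV. (\<chi> l. (snd p + snd p + fst p) $ l mod 2,
        \<chi> l. (snd p + snd p + fst p) $ l div 2) = (p :: (int^'d) \<times> (int^'d))"
    proof
      have parity: "(x + x + y) mod 2 = y" "(x + x + y) div 2 = x" if "y = 0 \<or> y = 1" for x y :: int
        using that by presburger+
      fix p :: "(int^'d) \<times> (int^'d)" assume "p \<in> cube \<times> UNIV"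
      then have "fst p $ l = 0 \<or> fst p $ l = 1" for l by (auto simp: cube_def)
      then show "(\<chi> l. (snd p + snd p + fst p) $ l mod 2, \<chi> l. (snd p + snd p + fst p) $ l div 2) = p"
        by (simp only: prod_eq_iff vec_eq_iff fst_conv snd_conv vec_lambda_beta vector_add_component
            parity) simp
    qed
    have "x div 2 + x div 2 + x mod 2 = x" for x :: int by presburger
    then show "\<forall>n\<in>UNIV. snd (\<chi> l. n $ l mod 2, \<chi> l. n $ l div 2) + snd (\<chi> l. n $ l mod 2, \<chi> l. n $ l div 2)
        + fst (\<chi> l. n $ l mod 2, \<chi> l. n $ l div 2) = (n :: int^'d)"
      by (simp only: vec_eq_iff fst_conv snd_conv vec_lambda_beta vector_add_component) simp
  qed (auto simp: cube_def)
  have "F z = (\<Sum>k\<in>cube. P k (square_point z) * monomial z k)" if z: "z \<in> torus" for z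
  proof -
    have s2: "(\<lambda>p. a (snd p + snd p + fst p) * monomial z (snd p + snd p + fst p)) summable_on cube \<times> UNIV"
      using summable_on_reindex_bij_betw [OF bij, of "\<lambda>k. a k * monomial z k"] a(3) [OF z] by simp
    have "F z = (\<Sum>\<^sub>\<infinity>p\<in>cube \<times> UNIV. a (snd p + snd p + fst p) * monomial z (snd p + snd p + fst p))"
      using infsum_reindex_bij_betw [OF bij, of "\<lambda>k. a k * monomial z k"] a(2) [OF z] by simp
    also have "\<dots> = (\<Sum>k\<in>cube. \<Sum>\<^sub>\<infinity>m. a (m + m + k) * monomial z (m + m + k))"
      using infsum_Sigma_banach [OF s2] by simp
    also have "\<dots> = (\<Sum>k\<in>cube. P k (square_point z) * monomial z k)"
      unfolding P_def
      by (intro sum.cong refl)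
        (simp only: monomial_add [of _ "_ + _"] monomial_square_point z
          mult.assoc [symmetric] infsum_cmult_left')
    finally show ?thesis .
  qed
  moreover have "(\<lambda>z. P k (square_point z)) \<in> laurent_l1_down" for k
    using P unfolding laurent_l1_down_def by blast
  ultimately show thesis
    using that [of "\<lambda>k z. P k (square_point z)"] by blast
qed

text \<open>Parseval with the indicator of \<open>k\<close> as second family. This inversion formula
  recovers a component from the values at the twists and so also shows that components are
  unique.\<close>

lemma polyphase_component:
  fixes z :: "complex^'d::finite"
  assumes z: "z \<in> torus" and k: "k \<in> cube"
    and F: "\<And>s. F (sign_twist s z) = (\<Sum>k\<in>cube. f k * monomial (sign_twist s z) k)"
  shows "2 ^ CARD('d) * f k = (\<Sum>s\<in>cube. F (sign_twist s z) * cnj (monomial (sign_twist s z) k))"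
proof -
  have "(\<Sum>l\<in>cube. of_bool (l = k) * monomial w l) = monomial w k" for w :: "complex^'d"
    using k by (simp add: of_bool_def if_distrib [of cnj] if_distribR mult_if_delta)
  moreover have "(\<Sum>l\<in>cube. f l * cnj (of_bool (l = k))) = f k"
    using k by (simp add: of_bool_def if_distrib [of cnj] if_distrib [of "(*) _"] cong: if_cong)
  ultimately show ?thesis
    using polyphase_parseval [OF z, of f "\<lambda>l. of_bool (l = k)"] by (simp add: F)
qed

text \<open>Averaging an invariant \<open>F\<close> over all twists returns \<open>F\<close>, yet it
  isolates the component at exponent 0, which lies in the subring. Membership in the subring thus
  reduces to invariance, without handling coefficients.\<close>

lemma laurent_l1_downI:
  fixes F :: "complex^'d::finite \<Rightarrow> complex"
  assumes F: "F \<in> laurent_l1"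
    and inv: "\<And>s z. s \<in> cube \<Longrightarrow> z \<in> torus \<Longrightarrow> F (sign_twist s z) = F z"
  shows "F \<in> laurent_l1_down"
proof -
  obtain f where f: "\<And>k. f k \<in> laurent_l1_down"
    "\<And>z. z \<in> torus \<Longrightarrow> F z = (\<Sum>k\<in>cube. f k z * monomial z k)"
    using F by (rule polyphase_decomposition) blast
  have "F z = f 0 z" if z: "z \<in> torus" for z
  proof -
    have "2 ^ CARD('d) * f 0 z = (\<Sum>s\<in>cube. F (sign_twist s z) * cnj (monomial (sign_twist s z) 0))"
      using z by (intro polyphase_component)
        (auto simp: f(2) sign_twist_torus laurent_l1_down_sign_twist [OF f(1)])
    also have "\<dots> = of_nat (card (cube :: (int^'d) set)) * F z"
      using inv z by simp
    also have "card (cube :: (int^'d) set) = 2 ^ CARD('d)"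
      unfolding cube_def by (subst card_vec_box) (auto simp: numeral_2_eq_2)
    finally show ?thesis by simp
  qed
  then show ?thesis
    using f(1) [of 0] unfolding laurent_l1_down_def by simp
qed

lemma laurent_l1_down_mult:
  "F \<in> laurent_l1_down \<Longrightarrow> G \<in> laurent_l1_down \<Longrightarrow> (\<lambda>z. F z * G z) \<in> laurent_l1_down"
  by (rule laurent_l1_downI) (simp_all add: laurent_l1_mult laurent_l1_down_imp_l1 laurent_l1_down_sign_twist)

lemma laurent_l1_diff:
  "F \<in> laurent_l1 \<Longrightarrow> G \<in> laurent_l1 \<Longrightarrow> (\<lambda>z. F z - G z) \<in> laurent_l1"
  using laurent_l1_add [OF _ laurent_l1_mult [OF laurent_polys_imp_l1 [OF laurent_polys_const [of "- 1"]]], of F G]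
  by simp

lemma laurent_l1_down_diff:
  "F \<in> laurent_l1_down \<Longrightarrow> G \<in> laurent_l1_down \<Longrightarrow> (\<lambda>z. F z - G z) \<in> laurent_l1_down"
  by (rule laurent_l1_downI) (simp_all add: laurent_l1_diff laurent_l1_down_imp_l1 laurent_l1_down_sign_twist)

lemma laurent_l1_down_cnj: "F \<in> laurent_l1_down \<Longrightarrow> (\<lambda>z. cnj (F z)) \<in> laurent_l1_down"
  by (rule laurent_l1_downI) (simp_all add: laurent_l1_cnj laurent_l1_down_imp_l1 laurent_l1_down_sign_twist)

lemma laurent_l1_sum:
  "finite I \<Longrightarrow> (\<And>i. i \<in> I \<Longrightarrow> F i \<in> laurent_l1) \<Longrightarrow> (\<lambda>z. \<Sum>i\<in>I. F i z) \<in> laurent_l1"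
  by (induction I rule: finite_induct)
    (auto intro: laurent_l1_add laurent_polys_imp_l1 laurent_polys_const)

section \<open>Orthogonal completion of the refinement mask\<close>

text \<open>The inversion lemma applies only to Laurent polynomials, so summable coefficients would
  not be enough to invert \<open>bracket \<Phi> H H\<close>.\<close>

lemma laurent_polys_bracket:
  assumes "\<Phi> \<in> laurent_polys" "F \<in> laurent_polys" "G \<in> laurent_polys"
  shows "bracket \<Phi> F G \<in> laurent_polys"
  unfolding bracket_def [abs_def]
  by (intro laurent_polys_sum laurent_polys_mult laurent_polys_cnj finite_cube
      laurent_polys_sign_twist [of \<Phi>] laurent_polys_sign_twist [of F] laurent_polys_sign_twist [of G] assms)

lemma laurent_l1_down_bracket:
  assumes "\<Phi> \<in> laurent_l1" "F \<in> laurent_l1" "G \<in> laurent_l1"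
  shows "bracket \<Phi> F G \<in> laurent_l1_down"
proof (rule laurent_l1_downI)
  show "bracket \<Phi> F G \<in> laurent_l1"
    unfolding bracket_def [abs_def]
    by (intro laurent_l1_sum laurent_l1_mult laurent_l1_cnj finite_cube
        laurent_l1_sign_twist [of \<Phi>] laurent_l1_sign_twist [of F] laurent_l1_sign_twist [of G] assms)
  show "bracket \<Phi> F G (sign_twist s z) = bracket \<Phi> F G z" if "s \<in> cube" for s z
    unfolding bracket_def by (rule sum_cube_sign_twist [OF that])
qed

lemma laurent_polys_autocorr_symbol:
  assumes "finite {k. autocorrelation \<phi> (int_to_real_vec k) \<noteq> 0}"
  shows "autocorr_symbol \<phi> \<in> laurent_polys"
proof (rule laurent_polysI [OF assms])
  fix z :: "complex^'a"
  have "autocorr_symbol \<phi> z = (\<Sum>\<^sub>\<infinity>k\<in>{k. autocorrelation \<phi> (int_to_real_vec k) \<noteq> 0}.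
      autocorrelation \<phi> (int_to_real_vec k) * monomial z k)"
    unfolding autocorr_symbol_def by (rule infsum_cong_neutral) auto
  also have "\<dots> = (\<Sum>k | autocorrelation \<phi> (int_to_real_vec k) \<noteq> 0.
      autocorrelation \<phi> (int_to_real_vec k) * monomial z k)"
    using assms by (rule infsum_finite)
  finally show "autocorr_symbol \<phi> z = (\<Sum>k | autocorrelation \<phi> (int_to_real_vec k) \<noteq> 0.
      autocorrelation \<phi> (int_to_real_vec k) * monomial z k)" .
qed

theorem corollary4p8:
  fixes \<phi> :: "real^'d::finite \<Rightarrow> complex"
    and H \<Phi> U :: "complex^'d \<Rightarrow> complex"
    and u Hs :: "int^'d \<Rightarrow> complex^'d \<Rightarrow> complex"
    and A B :: real and c :: complex and i :: "int^'d"
  assumes "integrable lebesgue \<phi>"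
    and "integrable lebesgue (\<lambda>x. (cmod (\<phi> x))\<^sup>2)"
    and "H \<in> laurent_polys"
    and "\<forall>v. fourier_transform \<phi> (2 *\<^sub>R v) = H (torus_point v) * fourier_transform \<phi> v"
    and "finite {k. autocorrelation \<phi> (int_to_real_vec k) \<noteq> 0}"
    and "\<Phi> = autocorr_symbol \<phi>"
    and "A > 0" and "B > 0"
    and "\<forall>z\<in>torus. \<Phi> z \<in> \<real> \<and> A \<le> Re (\<Phi> z) \<and> Re (\<Phi> z) \<le> B"
    and "c \<noteq> 0"
    and "\<forall>z\<in>torus. U z = c * H z * \<Phi> z"
    and "\<forall>j\<in>cube. u j \<in> laurent_l1_down"
    and "\<forall>z\<in>torus. U z = (\<Sum>j\<in>cube. u j z * monomial z j)"
    and "i \<in> cube" and "invertible_l1_down (u i)"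
    and "\<forall>j\<in>cube - {i}. \<forall>z\<in>torus.
           Hs (vec_abs (j - i)) z = cnj (u j z) * monomial z i - cnj (u i z) * monomial z j"
  shows "(\<forall>j\<in>cube - {0}. \<forall>z\<in>torus. bracket \<Phi> H (Hs j) z = 0) \<and>
         (\<forall>j\<in>cube - {0}. Hs j \<in> laurent_polys) \<and>
         l1_basis cube (Hs(0 := H))"
proof -
  note H = assms(3) and c = assms(10) and i = assms(14)
  \<comment> \<open>\<open>Hs\<close> is prescribed only at indices |j - i|. The bijection
    \<open>n\<close> lets the proof work with j \<noteq> i and carry the results to nonzero
    indices.\<close>
  define n where "n j = vec_abs (j - i)" for j
  have bij: "bij_betw n (cube - {i}) (cube - {0})"
    unfolding n_def by (rule bij_betw_vec_abs_diff [OF i])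
  have n0: "n j \<noteq> 0" "n j \<in> cube" if "j \<in> cube - {i}" for j
    using bij that by (auto dest: bij_betwE)
  have onto: "\<exists>j\<in>cube - {i}. k = n j" if "k \<in> cube - {0}" for k
    using bij that by (auto simp: bij_betw_def)
  have \<Phi>: "\<Phi> \<in> laurent_polys"
    using assms(5,6) laurent_polys_autocorr_symbol by simp
  have \<Phi>_real: "cnj (\<Phi> z) = \<Phi> z" and \<Phi>_pos: "Re (\<Phi> z) > 0" if "z \<in> torus" for z
    using assms(7,9) that by (force simp: Reals_cnj_iff)+
  have U: "U z = c * H z * \<Phi> z" "U z = (\<Sum>j\<in>cube. u j z * monomial z j)" if "z \<in> torus" for z
    using assms(11,13) that by blast+
  have u: "u j \<in> laurent_l1_down" if "j \<in> cube" for j using assms(12) that by blast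
  obtain v where v: "v \<in> laurent_l1_down" "\<And>z. z \<in> torus \<Longrightarrow> u i z * v z = 1"
    using assms(15) unfolding invertible_l1_down_def by blast
  have Hs: "Hs (n j) z = cnj (u j z) * monomial z i - cnj (u i z) * monomial z j"
    if "j \<in> cube - {i}" "z \<in> torus" for j z
    using assms(16) that unfolding n_def by blast
  have u_tw: "u j (sign_twist s z) = u j z" if "j \<in> cube" "z \<in> torus" for j s z
    using laurent_l1_down_sign_twist [OF u] that by blast
  have U_poly: "U \<in> laurent_polys"
  proof (rule laurent_polys_cong)
    show "(\<lambda>z. c * H z * \<Phi> z) \<in> laurent_polys"
      by (intro laurent_polys_mult laurent_polys_const H \<Phi>)
  qed (use U in simp)
  have comp_u: "2 ^ CARD('d) * u j z = (\<Sum>s\<in>cube. U (sign_twist s z) * cnj (monomial (sign_twist s z) j))"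
    if "j \<in> cube" "z \<in> torus" for j z
    using that by (intro polyphase_component) (auto simp: U(2) sign_twist_torus u_tw)
  \<comment> \<open>The \<open>u j\<close> are given as series, but they are averages of twists of
    the polynomial \<open>U\<close> against monomials, hence polynomials themselves, and so are the
    \<open>Hs k\<close>.\<close>
  have u_poly: "u j \<in> laurent_polys" if "j \<in> cube" for j
  proof (rule laurent_polys_cong)
    show "(\<lambda>z. 1 / 2 ^ CARD('d) *
        (\<Sum>s\<in>cube. U (sign_twist s z) * cnj (monomial (sign_twist s z) j))) \<in> laurent_polys"
      by (intro laurent_polys_mult laurent_polys_sum laurent_polys_const laurent_polys_cnj
          laurent_polys_sign_twist [of U] laurent_polys_sign_twist [of "\<lambda>z. monomial z j"]
          U_poly laurent_polys_monomial finite_cube)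
  qed (use that in \<open>simp flip: comp_u\<close>)
  have Hs_poly: "Hs k \<in> laurent_polys" if k: "k \<in> cube - {0}" for k
  proof -
    obtain j where j: "j \<in> cube - {i}" "k = n j" using onto [OF k] by blast
    have "(\<lambda>z. cnj (u j z) * monomial z i - cnj (u i z) * monomial z j) \<in> laurent_polys"
      using j(1) i
      by (intro laurent_polys_diff laurent_polys_mult laurent_polys_cnj u_poly laurent_polys_monomial) auto
    then show ?thesis
      by (rule laurent_polys_cong) (simp only: j(2) Hs [OF j(1)])
  qed
  \<comment> \<open>As \<open>\<Phi>\<close> is real on the torus, the factor cnj c turns \<Phi> *
    cnj H into cnj U. The weighted bracket becomes the plain inner product of components, those of
    \<open>U\<close> being \<open>u k z\<close>.\<close>
  have pairing: "cnj c * bracket \<Phi> F H z = 2 ^ CARD('d) * (\<Sum>k\<in>cube. f k * cnj (u k z))"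
    if z: "z \<in> torus" and F: "\<And>s. F (sign_twist s z) = (\<Sum>k\<in>cube. f k * monomial (sign_twist s z) k)"
    for F f z
  proof -
    have "cnj c * bracket \<Phi> F H z = (\<Sum>s\<in>cube. F (sign_twist s z) * cnj (U (sign_twist s z)))"
      using z by (simp add: bracket_def sum_distrib_left U(1) sign_twist_torus \<Phi>_real mult_ac)
    also have "\<dots> = (\<Sum>s\<in>cube. (\<Sum>k\<in>cube. f k * monomial (sign_twist s z) k)
        * cnj (\<Sum>k\<in>cube. u k z * monomial (sign_twist s z) k))"
      using z by (simp add: F U(2) sign_twist_torus u_tw)
    also have "\<dots> = 2 ^ CARD('d) * (\<Sum>k\<in>cube. f k * cnj (u k z))"
      by (rule polyphase_parseval [OF z])
    finally show ?thesis .
  qed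
  have orth: "bracket \<Phi> (Hs (n j)) H z = 0" if j: "j \<in> cube - {i}" and z: "z \<in> torus" for j z
  proof -
    \<comment> \<open>\<open>Hs (n j)\<close> has only two components, cnj u_j at \<open>i\<close>
      and -cnj u_i at \<open>j\<close>. Paired with cnj u they give equal products of opposite
      sign.\<close>
    define p where "p k = (if k = i then cnj (u j z) else 0) - (if k = j then cnj (u i z) else 0)" for k
    have p: "(\<Sum>k\<in>cube. p k * x k) = cnj (u j z) * x i - cnj (u i z) * x j" for x
    proof -
      have "(\<Sum>k\<in>cube. (if k = l then t else 0) * x k) = t * x l" if "l \<in> cube" for l t
        using that by (simp add: sum.remove [of cube l])
      then show ?thesis using i j by (simp add: p_def left_diff_distrib sum_subtractf)
    qed
    have "cnj c * bracket \<Phi> (Hs (n j)) H z = 2 ^ CARD('d) * (\<Sum>k\<in>cube. p k * cnj (u k z))"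
      by (rule pairing [OF z]) (use i j z in \<open>simp add: p Hs sign_twist_torus u_tw\<close>)
    also have "\<dots> = 0" by (simp add: p)
    finally show ?thesis using c by simp
  qed
  \<comment> \<open>\<open>pairing\<close> has \<open>H\<close> in the second slot, the claim has it
    in the first; the real weight makes the bracket Hermitian.\<close>
  have bracket_cnj: "bracket \<Phi> F G z = cnj (bracket \<Phi> G F z)" if "z \<in> torus" for F G z
    using that by (simp add: bracket_def \<Phi>_real sign_twist_torus mult_ac)
  have part1: "bracket \<Phi> H (Hs k) z = 0" if k: "k \<in> cube - {0}" and z: "z \<in> torus" for k z
  proof -
    obtain j where j: "j \<in> cube - {i}" "k = n j" using onto [OF k] by blast
    show ?thesis
      unfolding bracket_cnj [OF z, of H] j(2) orth [OF j(1) z] by simp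
  qed

  \<comment> \<open>Invertibility of the bracket of \<open>H\<close> with itself\<close>
  define W where "W = bracket \<Phi> H H"
  have W_nz: "W z \<noteq> 0" if z: "z \<in> torus" for z
  proof
    assume "W z = 0"
    have "Re (W z) = (\<Sum>s\<in>cube. Re (\<Phi> (sign_twist s z)) * (cmod (H (sign_twist s z)))\<^sup>2)"
    proof -
      have "Re (\<Phi> w * H w * cnj (H w)) = Re (\<Phi> w) * (cmod (H w))\<^sup>2" for w
        by (simp add: mult.assoc complex_norm_square [symmetric] flip: of_real_power)
      then show ?thesis by (simp only: W_def bracket_def Re_sum)
    qed
    moreover have "Re (\<Phi> (sign_twist s z)) * (cmod (H (sign_twist s z)))\<^sup>2 \<ge> 0" for s
      using \<Phi>_pos [OF sign_twist_torus [OF z], of s] by simp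
    ultimately have "\<forall>s\<in>cube. Re (\<Phi> (sign_twist s z)) * (cmod (H (sign_twist s z)))\<^sup>2 = 0"
      using \<open>W z = 0\<close> by (simp add: sum_nonneg_eq_0_iff)
    then have "\<forall>s\<in>cube. H (sign_twist s z) = 0"
      using \<Phi>_pos [OF sign_twist_torus [OF z]] by (simp add: less_imp_neq [symmetric])
    \<comment> \<open>\<open>u i z\<close> is an average of twists of U = c H \<Phi>, each of which
      now vanishes.\<close>
    then have "u i z = 0"
      using comp_u [OF i z] U(1) [OF sign_twist_torus [OF z]] by simp
    with v(2) [OF z] show False by simp
  qed
  have W_inv: "(\<lambda>z. 1 / W z) \<in> laurent_l1_down"
  proof (rule laurent_l1_downI)
    show "(\<lambda>z. 1 / W z) \<in> laurent_l1"
      unfolding W_def by (rule laurent_poly_inverse)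
        (use W_nz in \<open>simp_all add: laurent_polys_bracket H \<Phi> W_def\<close>)
    show "1 / W (sign_twist s z) = 1 / W z" if "s \<in> cube" for s z
      unfolding W_def bracket_def by (subst sum_cube_sign_twist [OF that]) simp
  qed

  \<comment> \<open>\<open>z\<close> and \<open>w\<close> are separate because the coefficients do
    not change under twists while the basis functions do: w = z serves generation, w a twist of z
    serves independence.\<close>
  have split: "(\<Sum>k\<in>cube. g k z * (Hs(0 := H)) k w)
      = g 0 z * H w + (\<Sum>j\<in>cube - {i}. g (n j) z * Hs (n j) w)" for g :: "_ \<Rightarrow> _ \<Rightarrow> complex" and z w
  proof -
    have "(\<Sum>k\<in>cube. g k z * (Hs(0 := H)) k w)
       = g 0 z * H w + (\<Sum>k\<in>cube - {0}. g k z * Hs k w)"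
      by (simp add: sum.remove [of cube 0])
    then show ?thesis
      using sum.reindex_bij_betw [OF bij, of "\<lambda>k. g k z * Hs k w"] by simp
  qed
  \<comment> \<open>These are the components of \<open>H\<close> itself, not of \<open>U\<close>:
    \<open>pairing\<close> evaluates \<open>W\<close> through the components of its first
    argument.\<close>
  obtain h where h: "\<And>k. h k \<in> laurent_l1_down"
    "\<And>z. z \<in> torus \<Longrightarrow> H z = (\<Sum>k\<in>cube. h k z * monomial z k)"
    using laurent_polys_imp_l1 [OF H] by (rule polyphase_decomposition) blast
  have h_tw: "h k (sign_twist s z) = h k z" if "z \<in> torus" for k s z
    using laurent_l1_down_sign_twist [OF h(1)] that by blast

  \<comment> \<open>Generation of the module\<close>
  have span: "\<exists>g. (\<forall>j\<in>cube. g j \<in> laurent_l1_down) \<and>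
      (\<forall>z\<in>torus. F z = (\<Sum>j\<in>cube. g j z * (Hs(0 := H)) j z))" if F: "F \<in> laurent_l1" for F
  proof -
    obtain f where f: "\<And>k. f k \<in> laurent_l1_down"
      "\<And>z. z \<in> torus \<Longrightarrow> F z = (\<Sum>k\<in>cube. f k z * monomial z k)"
      using F by (rule polyphase_decomposition) blast
    have f_tw: "f k (sign_twist s z) = f k z" if "z \<in> torus" for k s z
      using laurent_l1_down_sign_twist [OF f(1)] that by blast
    define m where "m = inv_into (cube - {i}) n"
    have m: "m (n j) = j" if "j \<in> cube - {i}" for j
      using bij that by (simp add: m_def bij_betw_def)
    define g0 where "g0 z = bracket \<Phi> F H z * (1 / W z)" for z
    \<comment> \<open>\<open>r\<close> holds the components of g0 H - F, which is orthogonal to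
      \<open>H\<close>. Apart from g0 H, the monomial z^j with j \<noteq> i occurs only in
      \<open>Hs (n j)\<close>, with factor -cnj u_i; this forces the coefficient r_j / cnj u_i, that
      is \<open>r j z * cnj (v z)\<close>.\<close>
    define r where "r k z = g0 z * h k z - f k z" for k z
    define g where "g k = (if k = 0 then g0 else (\<lambda>z. r (m k) z * cnj (v z)))" for k
    have g0: "g0 \<in> laurent_l1_down"
      unfolding g0_def [abs_def]
      by (rule laurent_l1_down_mult [OF laurent_l1_down_bracket W_inv])
        (simp_all add: laurent_polys_imp_l1 \<Phi> H F)
    have r: "r k \<in> laurent_l1_down" for k
      unfolding r_def [abs_def] by (intro laurent_l1_down_diff laurent_l1_down_mult g0 h f)
    have g: "g k \<in> laurent_l1_down" for k
      using laurent_l1_down_mult [OF r laurent_l1_down_cnj [OF v(1)]] g0 by (simp add: g_def)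
    have "F z = (\<Sum>j\<in>cube. g j z * (Hs(0 := H)) j z)" if z: "z \<in> torus" for z
    proof -
      have "cnj c * bracket \<Phi> F H z = 2 ^ CARD('d) * (\<Sum>k\<in>cube. f k z * cnj (u k z))"
        by (rule pairing [OF z]) (simp add: f(2) f_tw sign_twist_torus z)
      moreover have "cnj c * W z = 2 ^ CARD('d) * (\<Sum>k\<in>cube. h k z * cnj (u k z))"
        unfolding W_def by (rule pairing [OF z]) (simp add: h(2) h_tw sign_twist_torus z)
      moreover have "cnj c * bracket \<Phi> F H z = g0 z * (cnj c * W z)"
        using W_nz [OF z] by (simp add: g0_def)
      ultimately have "2 ^ CARD('d) * (\<Sum>k\<in>cube. f k z * cnj (u k z))
          = 2 ^ CARD('d) * (g0 z * (\<Sum>k\<in>cube. h k z * cnj (u k z)))"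
        by simp
      then have "(\<Sum>k\<in>cube. f k z * cnj (u k z)) = g0 z * (\<Sum>k\<in>cube. h k z * cnj (u k z))"
        by simp
      then have "(\<Sum>k\<in>cube. r k z * cnj (u k z)) = 0"
        by (simp add: r_def left_diff_distrib sum_subtractf sum_distrib_left mult.assoc)
      \<comment> \<open>The chosen coefficients already match every z^j with j \<noteq> i.
        Orthogonality to \<open>H\<close> is the one remaining equation and settles z^i.\<close>
      then have key: "(\<Sum>k\<in>cube - {i}. r k z * cnj (u k z)) = - (r i z * cnj (u i z))"
        using i by (simp add: sum.remove [of cube i] eq_neg_iff_add_eq_0 add.commute)
      have vu: "cnj (v z) * cnj (u i z) = 1"
        using v(2) [OF z] by (metis complex_cnj_mult complex_cnj_one mult.commute)
      have "(\<Sum>j\<in>cube. g j z * (Hs(0 := H)) j z)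
          = g0 z * H z + (\<Sum>j\<in>cube - {i}. r j z * cnj (v z) *
              (cnj (u j z) * monomial z i - cnj (u i z) * monomial z j))"
        unfolding split using n0 z by (simp add: g_def m Hs)
      also have "(\<Sum>j\<in>cube - {i}. r j z * cnj (v z) *
              (cnj (u j z) * monomial z i - cnj (u i z) * monomial z j))
          = (\<Sum>j\<in>cube - {i}. r j z * cnj (u j z)) * (cnj (v z) * monomial z i)
            - (\<Sum>j\<in>cube - {i}. r j z * monomial z j) * (cnj (v z) * cnj (u i z))"
        by (simp add: right_diff_distrib sum_subtractf sum_distrib_left mult_ac)
      also have "\<dots> = - (r i z * monomial z i) * (cnj (v z) * cnj (u i z))
            - (\<Sum>j\<in>cube - {i}. r j z * monomial z j) * (cnj (v z) * cnj (u i z))"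
        by (simp add: key mult_ac)
      also have "\<dots> = - (\<Sum>j\<in>cube. r j z * monomial z j)"
        using i by (simp add: vu sum.remove [of cube i])
      also have "g0 z * H z + \<dots> = F z"
        by (simp add: h(2) f(2) z r_def left_diff_distrib sum_subtractf sum_distrib_left mult.assoc)
      finally show ?thesis ..
    qed
    with g show ?thesis by blast
  qed

  \<comment> \<open>Linear independence\<close>
  have indep: "g k z = 0"
    if g: "\<forall>j\<in>cube. g j \<in> laurent_l1_down"
      and eq: "\<forall>z\<in>torus. (\<Sum>j\<in>cube. g j z * (Hs(0 := H)) j z) = 0"
      and k: "k \<in> cube" and z: "z \<in> torus" for g k z
  proof -
    have tw: "g j (sign_twist s z) = g j z" if "j \<in> cube" for j s
      using laurent_l1_down_sign_twist g that z by blast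
    \<comment> \<open>One relation on the torus yields 2^d relations at the twists of
      \<open>z\<close>, all with the same coefficients.\<close>
    have eq': "g 0 z * H (sign_twist s z)
        + (\<Sum>j\<in>cube - {i}. g (n j) z * Hs (n j) (sign_twist s z)) = 0" for s
    proof -
      have "(\<Sum>j\<in>cube. g j z * (Hs(0 := H)) j (sign_twist s z))
          = (\<Sum>j\<in>cube. g j (sign_twist s z) * (Hs(0 := H)) j (sign_twist s z))"
        by (intro sum.cong refl) (simp only: tw)
      then show ?thesis
        unfolding split [symmetric] using eq sign_twist_torus [OF z] by simp
    qed
    \<comment> \<open>The relation is paired with \<open>H\<close>: every \<open>Hs (n j)\<close>
      drops out by orthogonality, which leaves g_0 W = 0.\<close>
    have "0 = (\<Sum>s\<in>cube. \<Phi> (sign_twist s z) * (g 0 z * H (sign_twist s z)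
        + (\<Sum>j\<in>cube - {i}. g (n j) z * Hs (n j) (sign_twist s z))) * cnj (H (sign_twist s z)))"
      by (simp add: eq')
    also have "\<dots> = g 0 z * W z + (\<Sum>s\<in>cube. \<Sum>j\<in>cube - {i}. g (n j) z *
        (\<Phi> (sign_twist s z) * Hs (n j) (sign_twist s z) * cnj (H (sign_twist s z))))"
      by (simp add: W_def bracket_def distrib_left distrib_right sum.distrib sum_distrib_left
          sum_distrib_right mult_ac)
    also have "(\<Sum>s\<in>cube. \<Sum>j\<in>cube - {i}. g (n j) z *
        (\<Phi> (sign_twist s z) * Hs (n j) (sign_twist s z) * cnj (H (sign_twist s z))))
      = (\<Sum>j\<in>cube - {i}. g (n j) z * bracket \<Phi> (Hs (n j)) H z)"
      unfolding bracket_def sum_distrib_left by (rule sum.swap)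
    also have "\<dots> = 0" using orth z by simp
    finally have g0: "g 0 z = 0" using W_nz [OF z] by simp
    show ?thesis
    proof (cases "k = 0")
      case False
      then obtain j where j: "j \<in> cube - {i}" "k = n j" using onto k by blast
      \<comment> \<open>The remaining combination is regrouped by monomials: z^j with j \<noteq> i
        comes from \<open>Hs (n j)\<close> alone, while all of them contribute to z^i.\<close>
      define q where "q l = (if l = i then \<Sum>j\<in>cube - {i}. g (n j) z * cnj (u j z)
          else - (g (n l) z * cnj (u i z)))" for l
      have q: "0 = (\<Sum>l\<in>cube. q l * monomial (sign_twist s z) l)" for s
      proof -
        have "0 = (\<Sum>j\<in>cube - {i}. g (n j) z * Hs (n j) (sign_twist s z))"
          using eq' [of s] g0 by simp
        also have "\<dots> = (\<Sum>j\<in>cube - {i}. g (n j) z * (cnj (u j z) * monomial (sign_twist s z) i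
            - cnj (u i z) * monomial (sign_twist s z) j))"
          using i z by (simp add: Hs sign_twist_torus u_tw)
        also have "\<dots> = (\<Sum>l\<in>cube. q l * monomial (sign_twist s z) l)"
          using i by (simp add: sum.remove [of cube i] q_def right_diff_distrib sum_subtractf
              sum_distrib_left sum_negf mult_ac)
        finally show ?thesis .
      qed
      \<comment> \<open>The components of the zero function vanish, which isolates the single
        product of a coefficient with cnj u_i.\<close>
      have "2 ^ CARD('d) * q j = (\<Sum>s\<in>cube. 0 * cnj (monomial (sign_twist s z) j))"
        by (rule polyphase_component [OF z, where F = "\<lambda>_. 0"]) (use j q in auto)
      then have "g (n j) z * cnj (u i z) = 0" using j by (simp add: q_def)
      moreover have "u i z \<noteq> 0" using v(2) [OF z] by force
      ultimately show ?thesis using j by simp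
    qed (simp add: g0)
  qed

  have "l1_basis cube (Hs(0 := H))"
    unfolding l1_basis_def
  proof (intro conjI)
    show "\<forall>j\<in>cube. (Hs(0 := H)) j \<in> laurent_l1"
      using Hs_poly H by (auto intro: laurent_polys_imp_l1)
  qed (use span indep in \<open>simp_all del: fun_upd_apply\<close>)
  with part1 Hs_poly show ?thesis by blast
qed

end
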